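(* Suppose that Assumptions 1, 2, 3 and 4 (listed in the context) hold and that $f>f_0$ on $A$ for a constant $f_0>0$. Let $\widehat\sigma^2_{m_1}$ ($m_1\in\mathcal M_n$) and $\widehat g_{m_2}$ ($m_2\in\mathcal M_n$) be the least-squares contrast estimators of $\sigma^2$ and $g$ defined in the context, let $\widehat f_h$ be an estimator of $f$ with tuning parameter $h>0$, and for $z=(m_1,m_2,h)$ define $$\widehat a_z^2(x)=\frac{\widehat g_{m_2}(x)-\widehat\sigma_{m_1}^2(x)}{\widehat f_h(x)}\,\mathbf 1_{\{\widehat f_h(x)>f_0/2\}}.$$ Then $$\mathbb E\big[\|\widehat a_z^2-a^2\|_n^2\big]\le\frac{12}{f_0^2}\Big(\mathbb E\big[\|\widehat g_{m_2}-g\|_n^2\big]+\mathbb E\big[\|\widehat\sigma_{m_1}^2-\sigma^2\|_n^2\big]+2a_1^4\,\mathbb E\big[\|f-\widehat f_h\|_n^2\big]\Big).$$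
   Context: **Model.** $M\ge1$ is a fixed integer, $\alpha>0$, $\zeta_i>0$, $c_{i,j}>0$ ($1\le i,j\le M$). $N=(N^{(1)},\dots,N^{(M)})$ is a multivariate counting process (linear Hawkes process) whose components a.s. never jump simultaneously, with intensity $\lambda=(\lambda^{(1)},\dots,\lambda^{(M)})$; $W$ is a standard Brownian motion independent of $N$; the initial values $X_0,\lambda_0$ are random variables independent of the others; and $$d\lambda^{(i)}_t=-\alpha(\lambda^{(i)}_t-\zeta_i)dt+\sum_{j=1}^Mc_{i,j}dN^{(j)}_t\ (1\le i\le M),\qquad dX_t=b(X_t)dt+\sigma(X_t)dW_t+a(X_{t^-})\sum_{j=1}^MdN^{(j)}_t .$$ **Assumption 1.** (1) $b,\sigma$ are of class $C^2$ and there is a constant $c>0$ with $|b'(x)|+|\sigma'(x)|+|a'(x)|\le c$ for all $x\in\mathbb R$. (2) There are constants $a_1,\sigma_1>0$ with $|a(x)|<a_1$ and $0<\sigma^2(x)<\sigma_1^2$ for all $x$. (3) There are $c',q>0$ with $|b''(x)|+|\sigma''(x)|\le c'(1+|x|^q)$ for all $x$. (4) There are $d\ge0$, $r>0$ with $xb(x)\le-dx^2$ for all $|x|>r$. **Assumption 2.** The matrix $H=(c_{i,j}/\alpha)_{1\le i,j\le M}$ has spectral radius smaller than 1 and is invertible; $\sum_j\zeta_j>0$. Under Assumptions 1 and 2, by results quoted from the literature, $(X,\lambda)$ is positive Harris recurrent with a unique invariant probability $\pi$. **Assumption 3.** $(X_0,\lambda_0)$ has law $\pi$ (stationary regime). **Observations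 and norm.** $X$ is observed at times $0=t_0\le t_1\le\dots\le t_n=T_n$; $\Delta_{n,i}=t_{i+1}-t_i$, $\Delta_n=\max_i\Delta_{n,i}$, $\Delta_iX=X_{t_{i+1}}-X_{t_i}$. As $n\to\infty$, $\Delta_n\to0$, $n\Delta_n\to\infty$, $\log n=o(\sqrt{n\Delta_n})$, and the maximal and minimal steps differ only by a constant factor. $A\subset\mathbb R$ is a compact interval and $\|t\|_n^2=\frac1n\sum_{i=0}^{n-1}t^2(X_{t_i})\mathbf 1_A(X_{t_i})$. **Approximation spaces.** For $m$ in an index set $\mathcal M_n$, $\mathcal S_m$ is a linear subspace of $L^2(A)$ (with norm $\|\cdot\|$) of dimension $D_m$, spanned by $D_m$ elements of an orthonormal basis of $L^2(A)$. **Assumption 4.** (1) There is $\phi_1$ such that $\|t\|_\infty^2\le\phi_1D_m\|t\|^2$ for any $t\in\mathcal S_m$. (2) There is a space $\tilde{\mathcal S}_n$ belonging to the collection with $\mathcal S_m\subset\tilde{\mathcal S}_n$ for all $m\in\mathcal M_n$. (3) For any $d>0$ there is $\tilde\varepsilon>0$ such that for any $\varepsilon<\tilde\varepsilon$, $\sum_{m\in\mathcal M_n}e^{-dD_m^{1-\varepsilon}}\le\Sigma(d)$, where $\Sigma(d)$ is a finite constant depending only on $d$. **Targets.** $f(x)=\sum_{j=1}^M\mathbb E[\lambda_{t_i}^{(j)}\mid X_{t_i}=x]$ (under the stationary law; independent of $i$) and $g(x)=\sigma^2(x)+a^2(x)f(x)$. **Estimators.** $T_{t_i}=\frac1{\Delta_n}(\Delta_iX)^2$.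 With $\beta\in(0,\frac12)$ and $\varphi$ a fixed bounded function (a version of the indicator function) with $\varphi(\zeta)=1$ for $|\zeta|\le1$, $\varphi(\zeta)=0$ for $|\zeta|\ge2$, and $\varphi_z(\cdot)=\varphi(\cdot/z)$ for $z>0$, $$\widehat\sigma^2_m=\arg\min_{t\in\mathcal S_m}\frac1n\sum_{i=0}^{n-1}\big(t(X_{t_i})-T_{t_i}\varphi_{\Delta_{n,i}^\beta}(\Delta_iX)\big)^2\mathbf 1_A(X_{t_i}),\qquad \widehat g_m=\arg\min_{t\in\mathcal S_m}\frac1n\sum_{i=0}^{n-1}\big(t(X_{t_i})-T_{t_i}\big)^2\mathbf 1_A(X_{t_i}).$$ *)

theory Defs
  imports "HOL-Probability.Probability" "HOL-Library.Landau_Symbols"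
begin

section \<open>Paths\<close>

definition left_limit :: "(real \<Rightarrow> 'b::t2_space) \<Rightarrow> real \<Rightarrow> 'b" where
  "left_limit x s = Lim (at_left s) x"

definition cadlag :: "(real \<Rightarrow> 'b::t2_space) \<Rightarrow> bool" where
  "cadlag x \<longleftrightarrow>
     (\<forall>t\<ge>0. (x \<longlongrightarrow> x t) (at_right t)) \<and> (\<forall>t>0. \<exists>l. (x \<longlongrightarrow> l) (at_left t))"

definition counting_path :: "(real \<Rightarrow> nat) \<Rightarrow> bool" where
  "counting_path n \<longleftrightarrow>
     n 0 = 0 \<and> mono_on {0..} n \<and> (\<forall>t\<ge>0. (n \<longlongrightarrow> n t) (at_right t)) \<and>
     (\<forall>t>0. n t \<le> left_limit n t + 1)"

definition jump_times :: "(real \<Rightarrow> nat) \<Rightarrow> real set" where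
  "jump_times n = {s. 0 < s \<and> n s \<noteq> left_limit n s}"


section \<open>Filtered probability spaces\<close>

text \<open>Processes are indexed by \<^typ>\<open>real\<close>, and only times \<open>t \<ge> 0\<close> are constrained.
  A filtration on \<open>[0, \<infinity>)\<close> is extended to negative times in any monotone way,
  e.g. by \<open>F t = F 0\<close>.\<close>

definition filtered_prob_space :: "'w measure \<Rightarrow> (real \<Rightarrow> 'w measure) \<Rightarrow> bool" where
  "filtered_prob_space P F \<longleftrightarrow>
     prob_space P \<and> filtration (space P) F \<and> (\<forall>t. subalgebra P (F t))"

definition progressive ::
  "(real \<Rightarrow> 'w measure) \<Rightarrow> (real \<Rightarrow> 'w \<Rightarrow> real) \<Rightarrow> bool" where
  "progressive F H \<longleftrightarrow>
     (\<forall>t\<ge>0. (\<lambda>(s, \<omega>). H s \<omega>) \<in> borel_measurable (restrict_space borel {0..t} \<Otimes>\<^sub>M F t))"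

definition tendsto_in_prob :: "'w measure \<Rightarrow> (nat \<Rightarrow> 'w \<Rightarrow> real) \<Rightarrow> ('w \<Rightarrow> real) \<Rightarrow> bool" where
  "tendsto_in_prob P Z z \<longleftrightarrow>
     (\<forall>\<epsilon>>0. (\<lambda>k. measure P {\<omega> \<in> space P. \<epsilon> < \<bar>Z k \<omega> - z \<omega>\<bar>}) \<longlonglongrightarrow> 0)"

definition martingale ::
  "'w measure \<Rightarrow> (real \<Rightarrow> 'w measure) \<Rightarrow> (real \<Rightarrow> 'w \<Rightarrow> real) \<Rightarrow> bool" where
  "martingale P F Y \<longleftrightarrow>
     (\<forall>t\<ge>0. Y t \<in> borel_measurable (F t) \<and> integrable P (Y t)) \<and>
     (\<forall>s t. 0 \<le> s \<and> s \<le> t \<longrightarrow> (AE \<omega> in P. real_cond_exp P (F s) (Y t) \<omega> = Y s \<omega>))"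

definition local_martingale ::
  "'w measure \<Rightarrow> (real \<Rightarrow> 'w measure) \<Rightarrow> (real \<Rightarrow> 'w \<Rightarrow> real) \<Rightarrow> bool" where
  "local_martingale P F Y \<longleftrightarrow> (\<exists>\<tau> :: nat \<Rightarrow> 'w \<Rightarrow> real.
     (\<forall>k. stopping_time F (\<tau> k) \<and> (\<forall>\<omega>\<in>space P. 0 \<le> \<tau> k \<omega>)) \<and>
     (AE \<omega> in P. incseq (\<lambda>k. \<tau> k \<omega>) \<and> filterlim (\<lambda>k. \<tau> k \<omega>) at_top sequentially) \<and>
     (\<forall>k. martingale P F (\<lambda>t \<omega>. Y (min t (\<tau> k \<omega>)) \<omega>)))"

definition generated :: "'w measure \<Rightarrow> ('w \<Rightarrow> 'b) \<Rightarrow> 'b measure \<Rightarrow> 'w set set" where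
  "generated P Y M = sets (vimage_algebra (space P) Y M)"


section \<open>Brownian motion and the Ito integral\<close>

definition brownian_motion ::
  "'w measure \<Rightarrow> (real \<Rightarrow> 'w measure) \<Rightarrow> (real \<Rightarrow> 'w \<Rightarrow> real) \<Rightarrow> bool" where
  "brownian_motion P F W \<longleftrightarrow>
     (\<forall>t\<ge>0. W t \<in> borel_measurable (F t)) \<and>
     (AE \<omega> in P. W 0 \<omega> = 0 \<and> continuous_on {0..} (\<lambda>t. W t \<omega>)) \<and>
     (\<forall>s t. 0 \<le> s \<and> s < t \<longrightarrow>
        distributed P lborel (\<lambda>\<omega>. W t \<omega> - W s \<omega>) (normal_density 0 (sqrt (t - s))) \<and>
        prob_space.indep_set P (sets (F s)) (generated P (\<lambda>\<omega>. W t \<omega> - W s \<omega>) borel))"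

text \<open>The simple integrand \<open>\<Sum>k<m. \<xi>\<^sub>k 1\<^bsub>(\<tau>\<^sub>k, \<tau>\<^sub>k\<^sub>+\<^sub>1]\<^esub>\<close>
  with bounded, \<open>F \<tau>\<^sub>k\<close>-measurable \<open>\<xi>\<^sub>k\<close>, and its integral.\<close>

definition simple_integrand ::
  "'w measure \<Rightarrow> (real \<Rightarrow> 'w measure) \<Rightarrow> nat \<Rightarrow> (nat \<Rightarrow> real) \<Rightarrow> (nat \<Rightarrow> 'w \<Rightarrow> real) \<Rightarrow> bool" where
  "simple_integrand P F m \<tau> \<xi> \<longleftrightarrow>
     0 \<le> \<tau> 0 \<and> (\<forall>k<m. \<tau> k \<le> \<tau> (Suc k)) \<and>
     (\<forall>k<m. \<xi> k \<in> borel_measurable (F (\<tau> k)) \<and> (\<exists>B. \<forall>\<omega>\<in>space P. \<bar>\<xi> k \<omega>\<bar> \<le> B))"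

definition simple_value ::
  "nat \<Rightarrow> (nat \<Rightarrow> real) \<Rightarrow> (nat \<Rightarrow> 'w \<Rightarrow> real) \<Rightarrow> real \<Rightarrow> 'w \<Rightarrow> real" where
  "simple_value m \<tau> \<xi> s \<omega> = (\<Sum>k<m. \<xi> k \<omega> * indicator {\<tau> k<..\<tau> (Suc k)} s)"

definition simple_integral ::
  "(real \<Rightarrow> 'w \<Rightarrow> real) \<Rightarrow> nat \<Rightarrow> (nat \<Rightarrow> real) \<Rightarrow> (nat \<Rightarrow> 'w \<Rightarrow> real) \<Rightarrow> real \<Rightarrow> 'w \<Rightarrow> real" where
  "simple_integral W m \<tau> \<xi> t \<omega> =
     (\<Sum>k<m. \<xi> k \<omega> * (W (min (\<tau> (Suc k)) t) \<omega> - W (min (\<tau> k) t) \<omega>))"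

text \<open>\<open>I\<close> is a continuous version of \<open>\<integral>\<^sub>0\<^sup>t H\<^sub>s dW\<^sub>s\<close>, where \<open>H\<close> is progressive and
  \<open>\<integral>\<^sub>0\<^sup>t H\<^sub>s\<^sup>2 ds < \<infinity>\<close> almost surely: the limit in probability of the integrals of simple
  integrands \<open>H\<^sup>k\<close> with \<open>\<integral>\<^sub>0\<^sup>t (H\<^sup>k\<^sub>s - H\<^sub>s)\<^sup>2 ds \<rightarrow> 0\<close> in probability.\<close>

definition is_ito_integral ::
  "'w measure \<Rightarrow> (real \<Rightarrow> 'w measure) \<Rightarrow> (real \<Rightarrow> 'w \<Rightarrow> real) \<Rightarrow> (real \<Rightarrow> 'w \<Rightarrow> real)
     \<Rightarrow> (real \<Rightarrow> 'w \<Rightarrow> real) \<Rightarrow> bool" where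
  "is_ito_integral P F W H I \<longleftrightarrow>
     progressive F H \<and>
     (AE \<omega> in P. \<forall>t\<ge>0. set_integrable lborel {0..t} (\<lambda>s. (H s \<omega>)\<^sup>2)) \<and>
     (\<forall>t\<ge>0. I t \<in> borel_measurable P) \<and>
     (AE \<omega> in P. continuous_on {0..} (\<lambda>t. I t \<omega>)) \<and>
     (\<exists>m \<tau> \<xi>. (\<forall>k. simple_integrand P F (m k) (\<tau> k) (\<xi> k)) \<and>
        (\<forall>t\<ge>0.
           tendsto_in_prob P
             (\<lambda>k \<omega>. LINT s:{0..t}|lborel. (simple_value (m k) (\<tau> k) (\<xi> k) s \<omega> - H s \<omega>)\<^sup>2)
             (\<lambda>\<omega>. 0) \<and>
           tendsto_in_prob P (\<lambda>k. simple_integral W (m k) (\<tau> k) (\<xi> k) t) (I t)))"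


section \<open>The jump diffusion driven by a Hawkes process\<close>

text \<open>\<open>l\<close> is a stochastic intensity of the counting process \<open>N\<close>:
  the compensator of \<open>N\<close> is \<open>\<integral>\<^sub>0\<^sup>t l\<^sub>s ds\<close>.\<close>

definition has_intensity ::
  "'w measure \<Rightarrow> (real \<Rightarrow> 'w measure) \<Rightarrow> (real \<Rightarrow> 'w \<Rightarrow> nat) \<Rightarrow> (real \<Rightarrow> 'w \<Rightarrow> real) \<Rightarrow> bool" where
  "has_intensity P F N l \<longleftrightarrow>
     (\<forall>t\<ge>0. N t \<in> measurable (F t) (count_space UNIV)) \<and>
     (\<forall>\<omega>\<in>space P. counting_path (\<lambda>t. N t \<omega>)) \<and>
     progressive F l \<and> (\<forall>t\<ge>0. \<forall>\<omega>\<in>space P. 0 \<le> l t \<omega>) \<and>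
     local_martingale P F (\<lambda>t \<omega>. real (N t \<omega>) - (LINT s:{0..t}|lborel. l s \<omega>))"

text \<open>The initial value \<open>(X\<^sub>0, \<lambda>\<^sub>0)\<close> is \<open>F\<^sub>0\<close>-measurable and, jointly with \<open>N\<close>, independent of
  \<open>W\<close>. It is not required to be independent of \<open>N\<close> itself, whose intensity starts at
  \<open>\<lambda>\<^sub>0\<close>: such an independence would force \<open>\<lambda>\<^sub>0\<close> to be deterministic.\<close>

definition hawkes_jump_diffusion ::
  "real \<Rightarrow> (real^'m) \<Rightarrow> (real^'m^'m) \<Rightarrow> (real \<Rightarrow> real) \<Rightarrow> (real \<Rightarrow> real) \<Rightarrow> (real \<Rightarrow> real)
     \<Rightarrow> 'w measure \<Rightarrow> (real \<Rightarrow> 'w measure) \<Rightarrow> (real \<Rightarrow> 'w \<Rightarrow> real) \<Rightarrow> ('m::finite \<Rightarrow> real \<Rightarrow> 'w \<Rightarrow> nat)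
     \<Rightarrow> (real \<Rightarrow> 'w \<Rightarrow> real) \<Rightarrow> (real \<Rightarrow> 'w \<Rightarrow> real^'m) \<Rightarrow> bool" where
  "hawkes_jump_diffusion \<alpha> \<zeta> c b \<sigma> a P F W N X lam \<longleftrightarrow>
     filtered_prob_space P F \<and>
     brownian_motion P F W \<and>
     (\<forall>j. has_intensity P F (N j) (\<lambda>t \<omega>. lam t \<omega> $ j)) \<and>
     (AE \<omega> in P. \<forall>i j. i \<noteq> j \<longrightarrow>
        jump_times (\<lambda>t. N i t \<omega>) \<inter> jump_times (\<lambda>t. N j t \<omega>) = {}) \<and>
     (\<forall>t\<ge>0. X t \<in> borel_measurable (F t) \<and> lam t \<in> borel_measurable (F t)) \<and>
     (\<forall>\<omega>\<in>space P. cadlag (\<lambda>t. X t \<omega>) \<and> cadlag (\<lambda>t. lam t \<omega>)) \<and>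
     prob_space.indep_set P
       (generated P (\<lambda>\<omega>. \<lambda>t\<in>{0..}. W t \<omega>) (\<Pi>\<^sub>M t\<in>{0::real..}. borel))
       (generated P (\<lambda>\<omega>. ((X 0 \<omega>, lam 0 \<omega>), \<lambda>(j, t)\<in>UNIV \<times> {0..}. N j t \<omega>))
          (borel \<Otimes>\<^sub>M (\<Pi>\<^sub>M jt\<in>UNIV \<times> {0::real..}. count_space UNIV))) \<and>
     (AE \<omega> in P. \<forall>t\<ge>0. \<forall>i. lam t \<omega> $ i =
        lam 0 \<omega> $ i - \<alpha> * (LINT s:{0..t}|lborel. lam s \<omega> $ i - \<zeta> $ i)
        + (\<Sum>j\<in>UNIV. c $ i $ j * real (N j t \<omega>))) \<and>
     (\<exists>I. is_ito_integral P F W (\<lambda>s \<omega>. \<sigma> (X s \<omega>)) I \<and>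
        (AE \<omega> in P. \<forall>t\<ge>0. X t \<omega> =
           X 0 \<omega> + (LINT s:{0..t}|lborel. b (X s \<omega>)) + I t \<omega>
           + (\<Sum>j\<in>UNIV. \<Sum>s\<in>jump_times (\<lambda>t. N j t \<omega>) \<inter> {0<..t}.
                a (left_limit (\<lambda>t. X t \<omega>) s))))"

text \<open>\<open>\<pi>\<close> is invariant for the Markov process \<open>(X, \<lambda>)\<close>: every solution started from \<open>\<pi>\<close> has
  marginal law \<open>\<pi>\<close> at all times. Solutions range over probability spaces on the type \<open>'w\<close>;
  as the equation is well posed, the law at time \<open>t\<close> does not depend on the solution.\<close>

definition invariant_law ::
  "'w itself \<Rightarrow> real \<Rightarrow> (real^'m) \<Rightarrow> (real^'m^'m) \<Rightarrow> (real \<Rightarrow> real) \<Rightarrow> (real \<Rightarrow> real)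
     \<Rightarrow> (real \<Rightarrow> real) \<Rightarrow> (real \<times> (real^'m::finite)) measure \<Rightarrow> bool" where
  "invariant_law _ \<alpha> \<zeta> c b \<sigma> a \<pi> \<longleftrightarrow>
     prob_space \<pi> \<and> sets \<pi> = sets borel \<and>
     (\<forall>(P :: 'w measure) F W N X lam.
        hawkes_jump_diffusion \<alpha> \<zeta> c b \<sigma> a P F W N X lam \<and>
        distr P borel (\<lambda>\<omega>. (X 0 \<omega>, lam 0 \<omega>)) = \<pi> \<longrightarrow>
        (\<forall>t\<ge>0. distr P borel (\<lambda>\<omega>. (X t \<omega>, lam t \<omega>)) = \<pi>))"


section \<open>Assumptions on the coefficients\<close>

definition C2 :: "(real \<Rightarrow> real) \<Rightarrow> bool" where
  "C2 u \<longleftrightarrow> u differentiable_on UNIV \<and> deriv u differentiable_on UNIV \<and>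
     continuous_on UNIV (deriv (deriv u))"

definition coefficient_assumption ::
  "(real \<Rightarrow> real) \<Rightarrow> (real \<Rightarrow> real) \<Rightarrow> (real \<Rightarrow> real) \<Rightarrow> real \<Rightarrow> bool" where
  "coefficient_assumption b \<sigma> a a\<^sub>1 \<longleftrightarrow>
     C2 b \<and> C2 \<sigma> \<and> a differentiable_on UNIV \<and>
     (\<exists>K>0. \<forall>x. \<bar>deriv b x\<bar> + \<bar>deriv \<sigma> x\<bar> + \<bar>deriv a x\<bar> \<le> K) \<and>
     0 < a\<^sub>1 \<and> (\<forall>x. \<bar>a x\<bar> < a\<^sub>1) \<and>
     (\<exists>\<sigma>\<^sub>1>0. \<forall>x. 0 < (\<sigma> x)\<^sup>2 \<and> (\<sigma> x)\<^sup>2 < \<sigma>\<^sub>1\<^sup>2) \<and>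
     (\<exists>K>0. \<exists>q>0. \<forall>x. \<bar>deriv (deriv b) x\<bar> + \<bar>deriv (deriv \<sigma>) x\<bar> \<le> K * (1 + \<bar>x\<bar> powr q)) \<and>
     (\<exists>d\<ge>0. \<exists>r>0. \<forall>x. \<bar>x\<bar> > r \<longrightarrow> x * b x \<le> - d * x\<^sup>2)"

definition spectral_radius :: "real^'m^'m::finite \<Rightarrow> real" where
  "spectral_radius H = Max (cmod `
     {k. \<exists>v :: complex^'m. v \<noteq> 0 \<and> map_matrix complex_of_real H *v v = k *s v})"

definition hawkes_assumption :: "real \<Rightarrow> (real^'m) \<Rightarrow> (real^'m^'m::finite) \<Rightarrow> bool" where
  "hawkes_assumption \<alpha> \<zeta> c \<longleftrightarrow>
     (let H = (\<chi> i j. c $ i $ j / \<alpha>) in spectral_radius H < 1 \<and> invertible H) \<and>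
     0 < (\<Sum>j\<in>UNIV. \<zeta> $ j)"


section \<open>Observation scheme\<close>

definition mesh :: "(nat \<Rightarrow> nat \<Rightarrow> real) \<Rightarrow> nat \<Rightarrow> real" where
  "mesh t n = Max ((\<lambda>i. t n (Suc i) - t n i) ` {..<n})"

text \<open>\<open>t n i\<close>, for \<open>i \<le> n\<close>, is the \<open>i\<close>-th of the observation times when there are \<open>n\<close> steps;
  the horizon is \<open>T\<^sub>n = t n n\<close>.\<close>

definition observation_scheme :: "(nat \<Rightarrow> nat \<Rightarrow> real) \<Rightarrow> bool" where
  "observation_scheme t \<longleftrightarrow>
     (\<forall>n\<ge>1. t n 0 = 0 \<and> (\<forall>i<n. t n i \<le> t n (Suc i))) \<and>
     mesh t \<longlonglongrightarrow> 0 \<and>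
     filterlim (\<lambda>n. real n * mesh t n) at_top sequentially \<and>
     (\<lambda>n. ln (real n)) \<in> o(\<lambda>n. sqrt (real n * mesh t n)) \<and>
     (\<exists>K. \<forall>n\<ge>1. \<forall>i<n. mesh t n \<le> K * (t n (Suc i) - t n i))"


section \<open>Approximation spaces\<close>

text \<open>Elements of \<open>L\<^sup>2(A)\<close> are represented by functions on the real line that vanish off \<open>A\<close>.\<close>

definition L2_on :: "real set \<Rightarrow> (real \<Rightarrow> real) set" where
  "L2_on A = {u. u \<in> borel_measurable borel \<and> (\<forall>x. x \<notin> A \<longrightarrow> u x = 0) \<and>
     set_integrable lborel A (\<lambda>x. (u x)\<^sup>2)}"

definition L2_norm_on :: "real set \<Rightarrow> (real \<Rightarrow> real) \<Rightarrow> real" where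
  "L2_norm_on A u = sqrt (LINT x:A|lborel. (u x)\<^sup>2)"

definition lin_comb :: "(real \<Rightarrow> real) set \<Rightarrow> ((real \<Rightarrow> real) \<Rightarrow> real) \<Rightarrow> real \<Rightarrow> real" where
  "lin_comb J \<theta> x = (\<Sum>e\<in>J. \<theta> e * e x)"

definition orthonormal_basis :: "real set \<Rightarrow> (real \<Rightarrow> real) set \<Rightarrow> bool" where
  "orthonormal_basis A B \<longleftrightarrow>
     B \<subseteq> L2_on A \<and>
     (\<forall>u\<in>B. \<forall>v\<in>B. (LINT x:A|lborel. u x * v x) = (if u = v then 1 else 0)) \<and>
     (\<forall>u\<in>L2_on A. \<forall>\<epsilon>>0. \<exists>J \<theta>. J \<subseteq> B \<and> finite J \<and>
        L2_norm_on A (\<lambda>x. u x - lin_comb J \<theta> x) < \<epsilon>)"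

definition approximation_space :: "real set \<Rightarrow> (real \<Rightarrow> real) set \<Rightarrow> nat \<Rightarrow> bool" where
  "approximation_space A S D \<longleftrightarrow>
     (\<exists>B J. orthonormal_basis A B \<and> J \<subseteq> B \<and> finite J \<and> card J = D \<and> S = range (lin_comb J))"

definition sup_norm_on :: "real set \<Rightarrow> (real \<Rightarrow> real) \<Rightarrow> ereal" where
  "sup_norm_on A u = (SUP x\<in>A. ereal \<bar>u x\<bar>)"

definition space_assumption ::
  "real set \<Rightarrow> (nat \<Rightarrow> 'i set) \<Rightarrow> ('i \<Rightarrow> (real \<Rightarrow> real) set) \<Rightarrow> ('i \<Rightarrow> nat) \<Rightarrow> bool" where
  "space_assumption A \<M> S D \<longleftrightarrow>
     (\<exists>\<phi>\<^sub>1. \<forall>n\<ge>1. \<forall>m\<in>\<M> n. \<forall>u\<in>S m.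
        (sup_norm_on A u)\<^sup>2 \<le> ereal (\<phi>\<^sub>1 * real (D m) * (L2_norm_on A u)\<^sup>2)) \<and>
     (\<forall>n\<ge>1. \<exists>m'\<in>\<M> n. \<forall>m\<in>\<M> n. S m \<subseteq> S m') \<and>
     (\<exists>\<Sigma> :: real \<Rightarrow> real. \<forall>d>0. \<exists>\<epsilon>'>0. \<forall>\<epsilon>. 0 < \<epsilon> \<and> \<epsilon> < \<epsilon>' \<longrightarrow>
        (\<forall>n\<ge>1. (\<lambda>m. exp (- d * real (D m) powr (1 - \<epsilon>))) summable_on \<M> n \<and>
           (\<Sum>\<^sub>\<infinity>m\<in>\<M> n. exp (- d * real (D m) powr (1 - \<epsilon>))) \<le> \<Sigma> d))"


section \<open>Targets and estimators\<close>

text \<open>\<open>\<phi>\<close> is a version of \<open>x \<mapsto> E[Y | Z = x]\<close>.\<close>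

definition is_regression :: "'w measure \<Rightarrow> ('w \<Rightarrow> real) \<Rightarrow> ('w \<Rightarrow> real) \<Rightarrow> (real \<Rightarrow> real) \<Rightarrow> bool" where
  "is_regression P Y Z \<phi> \<longleftrightarrow>
     \<phi> \<in> borel_measurable borel \<and>
     (AE \<omega> in P. real_cond_exp P (vimage_algebra (space P) Z borel) Y \<omega> = \<phi> (Z \<omega>))"

definition is_intensity_regression ::
  "'w measure \<Rightarrow> (real \<Rightarrow> 'w \<Rightarrow> real) \<Rightarrow> (real \<Rightarrow> 'w \<Rightarrow> real^'m::finite) \<Rightarrow> (nat \<Rightarrow> nat \<Rightarrow> real)
     \<Rightarrow> (real \<Rightarrow> real) \<Rightarrow> bool" where
  "is_intensity_regression P X lam t f \<longleftrightarrow>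
     (\<exists>\<phi> :: 'm \<Rightarrow> real \<Rightarrow> real.
        (\<forall>n\<ge>1. \<forall>i\<le>n. \<forall>j. is_regression P (\<lambda>\<omega>. lam (t n i) \<omega> $ j) (X (t n i)) (\<phi> j)) \<and>
        f = (\<lambda>x. \<Sum>j\<in>UNIV. \<phi> j x))"

text \<open>In the next two definitions \<open>y i\<close> stands for the observation \<open>X\<^bsub>t\<^sub>i\<^esub>(\<omega>)\<close>.\<close>

definition emp_norm_sq :: "real set \<Rightarrow> nat \<Rightarrow> (nat \<Rightarrow> real) \<Rightarrow> (real \<Rightarrow> real) \<Rightarrow> real" where
  "emp_norm_sq A n y u = (1 / real n) * (\<Sum>i<n. (u (y i))\<^sup>2 * indicator A (y i))"

definition contrast ::
  "real set \<Rightarrow> nat \<Rightarrow> (nat \<Rightarrow> real) \<Rightarrow> (nat \<Rightarrow> real) \<Rightarrow> (real \<Rightarrow> real) \<Rightarrow> real" where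
  "contrast A n y R u = (1 / real n) * (\<Sum>i<n. (u (y i) - R i)\<^sup>2 * indicator A (y i))"

definition truncation :: "(real \<Rightarrow> real) \<Rightarrow> bool" where
  "truncation \<phi> \<longleftrightarrow> bounded (range \<phi>) \<and>
     (\<forall>z. \<bar>z\<bar> \<le> 1 \<longrightarrow> \<phi> z = 1) \<and> (\<forall>z. \<bar>z\<bar> \<ge> 2 \<longrightarrow> \<phi> z = 0)"

definition sq_increment :: "(nat \<Rightarrow> nat \<Rightarrow> real) \<Rightarrow> nat \<Rightarrow> (nat \<Rightarrow> real) \<Rightarrow> nat \<Rightarrow> real" where
  "sq_increment t n y i = (1 / mesh t n) * (y (Suc i) - y i)\<^sup>2"

definition truncated_sq_increment ::
  "(nat \<Rightarrow> nat \<Rightarrow> real) \<Rightarrow> (real \<Rightarrow> real) \<Rightarrow> real \<Rightarrow> nat \<Rightarrow> (nat \<Rightarrow> real) \<Rightarrow> nat \<Rightarrow> real" where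
  "truncated_sq_increment t \<phi> \<beta> n y i =
     sq_increment t n y i * \<phi> ((y (Suc i) - y i) / (t n (Suc i) - t n i) powr \<beta>)"

definition random_function :: "'w measure \<Rightarrow> ('w \<Rightarrow> real \<Rightarrow> real) \<Rightarrow> bool" where
  "random_function P u \<longleftrightarrow> (\<lambda>(\<omega>, x). u \<omega> x) \<in> borel_measurable (P \<Otimes>\<^sub>M borel)"

text \<open>\<open>u \<omega>\<close> is a minimiser over \<open>S\<close> of the contrast with responses \<open>R (X\<^bsub>t\<^sub>0\<^esub>(\<omega>), X\<^bsub>t\<^sub>1\<^esub>(\<omega>), \<dots>)\<close>.
  Minimisers exist, but need not be unique as functions on \<open>A\<close>; only their values at the
  observations in \<open>A\<close> are determined.\<close>

definition least_squares_estimator ::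
  "'w measure \<Rightarrow> (real \<Rightarrow> 'w \<Rightarrow> real) \<Rightarrow> (nat \<Rightarrow> nat \<Rightarrow> real) \<Rightarrow> real set \<Rightarrow> nat
     \<Rightarrow> (real \<Rightarrow> real) set \<Rightarrow> ((nat \<Rightarrow> real) \<Rightarrow> nat \<Rightarrow> real) \<Rightarrow> ('w \<Rightarrow> real \<Rightarrow> real) \<Rightarrow> bool" where
  "least_squares_estimator P X t A n S R u \<longleftrightarrow>
     random_function P u \<and>
     (\<forall>\<omega>\<in>space P. let y = (\<lambda>i. X (t n i) \<omega>) in
        is_arg_min (contrast A n y (R y)) (\<lambda>v. v \<in> S) (u \<omega>))"

text \<open>Expectations of squared empirical norms are taken in \<open>[0, \<infinity>]\<close>.\<close>

definition risk ::
  "'w measure \<Rightarrow> (real \<Rightarrow> 'w \<Rightarrow> real) \<Rightarrow> (nat \<Rightarrow> nat \<Rightarrow> real) \<Rightarrow> real set \<Rightarrow> nat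
     \<Rightarrow> ('w \<Rightarrow> real \<Rightarrow> real) \<Rightarrow> (real \<Rightarrow> real) \<Rightarrow> ennreal" where
  "risk P X t A n u v =
     (\<integral>\<^sup>+\<omega>. ennreal (emp_norm_sq A n (\<lambda>i. X (t n i) \<omega>) (\<lambda>x. u \<omega> x - v x)) \<partial>P)"

definition jump_coefficient_estimator ::
  "real \<Rightarrow> ('w \<Rightarrow> real \<Rightarrow> real) \<Rightarrow> ('w \<Rightarrow> real \<Rightarrow> real) \<Rightarrow> ('w \<Rightarrow> real \<Rightarrow> real) \<Rightarrow> 'w \<Rightarrow> real \<Rightarrow> real" where
  "jump_coefficient_estimator f\<^sub>0 g_hat s_hat f_hat \<omega> x =
     (g_hat \<omega> x - s_hat \<omega> x) / f_hat \<omega> x * indicator {z. z > f\<^sub>0 / 2} (f_hat \<omega> x)"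

end

theory Submission
  imports Defs
begin

text \<open>On \<open>{f_hat > f\<^sub>0/2}\<close> the error is
  \<open>((g_hat - g) - (s_hat - \<sigma>\<^sup>2) + a\<^sup>2 (f - f_hat)) / f_hat\<close>, and \<open>1 / f_hat < 2 / f\<^sub>0\<close>. Off this set the
  estimator vanishes, but there \<open>f - f_hat > f\<^sub>0/2\<close>, so the error \<open>a\<^sup>2\<close> is at most
  \<open>(2 / f\<^sub>0) a\<^sup>2 \<bar>f - f_hat\<bar>\<close>. Squaring gives a pointwise bound, which passes to the expected
  empirical norms.\<close>

text \<open>Cauchy-Schwarz for the three numbers \<open>u\<close>, \<open>-v\<close>,
  \<open>w\<close>; the sign pattern is that of the error decomposition.\<close>

lemma square_add3_le:
  fixes u v w :: real
  shows "(u - v + w)\<^sup>2 \<le> 3 * (u\<^sup>2 + v\<^sup>2 + w\<^sup>2)"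
proof -
  \<comment> \<open>The gap is the sum of the squared pairwise differences of \<open>u\<close>,
    \<open>-v\<close> and \<open>w\<close>.\<close>
  have "3 * (u\<^sup>2 + v\<^sup>2 + w\<^sup>2) - (u - v + w)\<^sup>2 = (u + v)\<^sup>2 + (u - w)\<^sup>2 + (v + w)\<^sup>2"
    by (simp add: power2_eq_square algebra_simps)
  then show ?thesis
    by (smt (verit) zero_le_power2)
qed

text \<open>The value of g is written out as \<open>s + a\<^sup>2 * f\<close>, so that everything is
  a statement about real numbers. The constant 12 is 4 * 3: the 4 bounds
  \<open>1 / fh\<^sup>2\<close> above the threshold, the 3 comes from squaring a sum of three
  errors.\<close>

lemma thresholded_ratio_error_le:
  fixes f\<^sub>0 a\<^sub>1 a s f gh sh fh :: real
  assumes "f\<^sub>0 > 0" and "f > f\<^sub>0" and "\<bar>a\<bar> \<le> a\<^sub>1"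
  shows "((gh - sh) / fh * indicator {z. z > f\<^sub>0 / 2} fh - a\<^sup>2)\<^sup>2
    \<le> 12 / f\<^sub>0\<^sup>2 * ((gh - (s + a\<^sup>2 * f))\<^sup>2 + (sh - s)\<^sup>2 + 2 * a\<^sub>1 ^ 4 * (fh - f)\<^sup>2)"
proof -
  have a4: "a ^ 4 \<le> a\<^sub>1 ^ 4"
    using power_mono[OF assms(3), of 4] by simp
  have nn: "0 \<le> a ^ 4" "0 \<le> a\<^sub>1 ^ 4"
    by simp_all
  have a4F: "a ^ 4 * (fh - f)\<^sup>2 \<le> a\<^sub>1 ^ 4 * (fh - f)\<^sup>2"
    using a4 by (intro mult_right_mono) auto
  show ?thesis
  proof (cases "fh > f\<^sub>0 / 2")
    case True
    let ?u = "gh - (s + a\<^sup>2 * f)" and ?v = "sh - s" and ?w = "a\<^sup>2 * (f - fh)"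
    have "fh > 0" using True assms(1) by simp
    have inv: "1 / fh\<^sup>2 \<le> 4 / f\<^sub>0\<^sup>2"
    proof -
      have "(f\<^sub>0 / 2)\<^sup>2 \<le> fh\<^sup>2"
        using True assms(1) by (intro power_mono) auto
      then show ?thesis
        using assms(1) \<open>fh > 0\<close> by (simp add: field_simps power_divide)
    qed
    \<comment> \<open>Since \<open>a ^ 4\<close> is at most \<open>a\<^sub>1 ^ 4\<close>, the bound
      already holds with factor 1; the 2 is slack in the target constant.\<close>
    have w: "?w\<^sup>2 \<le> 2 * a\<^sub>1 ^ 4 * (fh - f)\<^sup>2"
    proof -
      have "?w\<^sup>2 = a ^ 4 * (fh - f)\<^sup>2"
        by (simp add: power_mult_distrib power2_commute)
      also have "\<dots> \<le> 2 * (a\<^sub>1 ^ 4 * (fh - f)\<^sup>2)"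
        using a4F mult_nonneg_nonneg[OF nn(2) zero_le_power2[of "fh - f"]] by linarith
      finally show ?thesis by (simp only: mult.assoc)
    qed
    \<comment> \<open>In \<open>?u - ?v + ?w\<close> the terms \<open>s\<close> and
      \<open>a\<^sup>2 * f\<close> cancel, leaving \<open>gh - sh - a\<^sup>2 * fh\<close>.\<close>
    have "((gh - sh) / fh * indicator {z. z > f\<^sub>0 / 2} fh - a\<^sup>2)\<^sup>2 = ((?u - ?v + ?w) / fh)\<^sup>2"
      using True \<open>fh > 0\<close> by (simp add: field_simps)
    also have "\<dots> = (1 / fh\<^sup>2) * (?u - ?v + ?w)\<^sup>2"
      by (simp add: power_divide)
    also have "\<dots> \<le> (4 / f\<^sub>0\<^sup>2) * (3 * (?u\<^sup>2 + ?v\<^sup>2 + ?w\<^sup>2))"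
      using inv square_add3_le[of ?u ?v ?w] by (intro mult_mono) auto
    also have "\<dots> = 12 / f\<^sub>0\<^sup>2 * (?u\<^sup>2 + ?v\<^sup>2 + ?w\<^sup>2)"
      by simp
    also have "\<dots> \<le> 12 / f\<^sub>0\<^sup>2 * (?u\<^sup>2 + ?v\<^sup>2 + 2 * a\<^sub>1 ^ 4 * (fh - f)\<^sup>2)"
      using w by (intro mult_left_mono) auto
    finally show ?thesis .
  next
    case False
    have "(f\<^sub>0 / 2)\<^sup>2 \<le> (f - fh)\<^sup>2"
      using False assms by (intro power_mono) auto
    \<comment> \<open>A missed threshold forces an error of \<open>fh\<close> of at least half of
      \<open>f\<^sub>0\<close>; this factor at least 1 turns the constant error \<open>a ^ 4\<close>
      into a multiple of the squared error of \<open>fh\<close>.\<close>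
    then have F: "1 \<le> 4 / f\<^sub>0\<^sup>2 * (fh - f)\<^sup>2"
      using assms(1) by (simp add: field_simps power_divide power2_commute)
    \<comment> \<open>The indicator is 0 here, so the ratio contributes nothing, even if
      \<open>fh\<close> is zero or negative.\<close>
    have "((gh - sh) / fh * indicator {z. z > f\<^sub>0 / 2} fh - a\<^sup>2)\<^sup>2 = a ^ 4 * 1"
      using False by simp
    also have "\<dots> \<le> a\<^sub>1 ^ 4 * (4 / f\<^sub>0\<^sup>2 * (fh - f)\<^sup>2)"
      using a4 F nn by (intro mult_mono) auto
    \<comment> \<open>Writing 4 as 12 / 3 produces the common prefactor; the remaining 1/3 is
      absorbed by the constant 2.\<close>
    also have "\<dots> = 12 / f\<^sub>0\<^sup>2 * (a\<^sub>1 ^ 4 * (fh - f)\<^sup>2 / 3)"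
      by simp
    also have "\<dots> \<le> 12 / f\<^sub>0\<^sup>2 *
        ((gh - (s + a\<^sup>2 * f))\<^sup>2 + (sh - s)\<^sup>2 + 2 * a\<^sub>1 ^ 4 * (fh - f)\<^sup>2)"
    proof (intro mult_left_mono)
      have "0 \<le> a\<^sub>1 ^ 4 * (fh - f)\<^sup>2" using nn by simp
      moreover have "0 \<le> (gh - (s + a\<^sup>2 * f))\<^sup>2" "0 \<le> (sh - s)\<^sup>2" by simp_all
      ultimately show "a\<^sub>1 ^ 4 * (fh - f)\<^sup>2 / 3
          \<le> (gh - (s + a\<^sup>2 * f))\<^sup>2 + (sh - s)\<^sup>2 + 2 * a\<^sub>1 ^ 4 * (fh - f)\<^sup>2"
        \<comment> \<open>Reassociating makes \<open>a\<^sub>1 ^ 4 * (fh - f)\<^sup>2\<close> one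
          and the same atom on both sides for \<open>linarith\<close>.\<close>
        unfolding mult.assoc by linarith
    qed simp
    finally show ?thesis .
  qed
qed

lemma emp_norm_sq_nonneg: "0 \<le> emp_norm_sq A n y u"
  unfolding emp_norm_sq_def by (intro mult_nonneg_nonneg sum_nonneg) auto

text \<open>The empirical norm averages squares with nonnegative weights that vanish off
  \<open>A\<close>, so a pointwise bound on \<open>A\<close> can be summed.\<close>

lemma emp_norm_sq_le_linear:
  assumes "\<And>x. x \<in> A \<Longrightarrow> (u x)\<^sup>2 \<le> C * ((v x)\<^sup>2 + (w x)\<^sup>2 + K * (z x)\<^sup>2)"
  shows "emp_norm_sq A n y u
    \<le> C * (emp_norm_sq A n y v + emp_norm_sq A n y w + K * emp_norm_sq A n y z)"
proof -
  \<comment> \<open>A name for the weight keeps it an opaque factor while the sums are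
    rearranged.\<close>
  define \<iota> where "\<iota> i = (indicator A (y i) :: real)" for i
  have "emp_norm_sq A n y u
      \<le> (1 / real n) * (\<Sum>i<n. C * ((v (y i))\<^sup>2 + (w (y i))\<^sup>2 + K * (z (y i))\<^sup>2) * \<iota> i)"
    unfolding emp_norm_sq_def \<iota>_def
    using assms by (intro mult_left_mono sum_mono) (auto simp: indicator_def)
  also have "\<dots> = C * (emp_norm_sq A n y v + emp_norm_sq A n y w + K * emp_norm_sq A n y z)"
    unfolding emp_norm_sq_def \<iota>_def[symmetric]
    by (simp add: sum.distrib sum_distrib_left algebra_simps)
  finally show ?thesis .
qed

text \<open>The outcome enters twice, through the random function and through the point where it is
  evaluated; joint measurability handles both at once.\<close>

lemma measurable_emp_norm_sq:
  assumes "random_function P u" and [measurable]: "v \<in> borel_measurable borel" "A \<in> sets borel"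
    and X: "\<And>i. i < n \<Longrightarrow> X (t n i) \<in> borel_measurable P"
  shows "(\<lambda>\<omega>. emp_norm_sq A n (\<lambda>i. X (t n i) \<omega>) (\<lambda>x. u \<omega> x - v x)) \<in> borel_measurable P"
proof -
  have term_measurable: "(\<lambda>\<omega>. (u \<omega> (X (t n i) \<omega>) - v (X (t n i) \<omega>))\<^sup>2 * indicator A (X (t n i) \<omega>))
      \<in> borel_measurable P" if "i < n" for i
  proof -
    note X[OF that, measurable]
    have "(\<lambda>\<omega>. (\<lambda>(\<omega>, x). u \<omega> x) (\<omega>, X (t n i) \<omega>)) \<in> borel_measurable P"
      using assms(1) unfolding random_function_def
      by (rule measurable_compose_rev) measurable
    then have [measurable]: "(\<lambda>\<omega>. u \<omega> (X (t n i) \<omega>)) \<in> borel_measurable P"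
      by simp
    show ?thesis by measurable
  qed
  show ?thesis
    unfolding emp_norm_sq_def
    by (intro borel_measurable_times borel_measurable_const borel_measurable_sum term_measurable)
      simp
qed

text \<open>Integrates the averaged bound over the outcomes. Monotonicity of the nonnegative
  integral asks for no measurability; additivity does, which is why the three functions on the right
  must be measurable.\<close>

lemma risk_le_linear:
  assumes bound: "\<And>\<omega> x. \<omega> \<in> space P \<Longrightarrow> x \<in> A \<Longrightarrow>
      (u \<omega> x - u' x)\<^sup>2 \<le> C * ((v \<omega> x - v' x)\<^sup>2 + (w \<omega> x - w' x)\<^sup>2 + K * (z \<omega> x - z' x)\<^sup>2)"
    and "0 \<le> C" "0 \<le> K"
    and "random_function P v" "random_function P w" "random_function P z"
    and "v' \<in> borel_measurable borel" "w' \<in> borel_measurable borel" "z' \<in> borel_measurable borel"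
    and "A \<in> sets borel" and "\<And>i. i < n \<Longrightarrow> X (t n i) \<in> borel_measurable P"
  shows "risk P X t A n u u'
    \<le> ennreal C * (risk P X t A n v v' + risk P X t A n w w' + ennreal K * risk P X t A n z z')"
proof -
  define E where "E u u' \<omega> = emp_norm_sq A n (\<lambda>i. X (t n i) \<omega>) (\<lambda>x. u \<omega> x - u' x)"
    for u :: "'a \<Rightarrow> real \<Rightarrow> real" and u' \<omega>
  have [measurable]: "E v v' \<in> borel_measurable P" "E w w' \<in> borel_measurable P"
    "E z z' \<in> borel_measurable P"
    unfolding E_def using assms(4-) by (auto intro!: measurable_emp_norm_sq)
  have nn: "0 \<le> E u u' \<omega>" for u u' \<omega>
    unfolding E_def by (rule emp_norm_sq_nonneg)
  have "risk P X t A n u u' \<le> (\<integral>\<^sup>+\<omega>. ennreal (C * (E v v' \<omega> + E w w' \<omega> + K * E z z' \<omega>)) \<partial>P)"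
    unfolding risk_def E_def
    by (intro nn_integral_mono ennreal_leI emp_norm_sq_le_linear bound)
  \<comment> \<open>Nonnegativity of \<open>C\<close>, \<open>K\<close> and the empirical norms lets
    \<open>ennreal\<close> distribute over the products and sums.\<close>
  also have "\<dots> = (\<integral>\<^sup>+\<omega>. ennreal C *
      (ennreal (E v v' \<omega>) + ennreal (E w w' \<omega>) + ennreal K * ennreal (E z z' \<omega>)) \<partial>P)"
    using assms(2,3) nn by (simp add: ennreal_mult ennreal_plus)
  also have "\<dots> = ennreal C * ((\<integral>\<^sup>+\<omega>. E v v' \<omega> \<partial>P) + (\<integral>\<^sup>+\<omega>. E w w' \<omega> \<partial>P)
      + ennreal K * (\<integral>\<^sup>+\<omega>. E z z' \<omega> \<partial>P))"
    by (simp add: nn_integral_cmult nn_integral_add)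
  finally show ?thesis
    unfolding risk_def E_def .
qed

lemma differentiable_on_imp_borel_measurable:
  fixes u :: "real \<Rightarrow> real"
  shows "u differentiable_on UNIV \<Longrightarrow> u \<in> borel_measurable borel"
  by (intro borel_measurable_continuous_onI differentiable_imp_continuous_on)

text \<open>Adaptedness of \<open>X\<close> is available at nonnegative times only, so the
  observation times have to be located there.\<close>

lemma observation_time_nonneg:
  assumes "observation_scheme t" "n \<ge> 1" "i \<le> n"
  shows "0 \<le> t n i"
  using assms(3)
proof (induction i)
  case 0
  then show ?case using assms unfolding observation_scheme_def by simp
next
  case (Suc i)
  then have "t n i \<le> t n (Suc i)"
    using assms unfolding observation_scheme_def by simp
  with Suc show ?case by simp
qed

lemma hawkes_jump_diffusion_measurable:
  assumes "hawkes_jump_diffusion \<alpha> \<zeta> c b \<sigma> a P F W N X lam" "0 \<le> s"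
  shows "X s \<in> borel_measurable P"
proof -
  have "X s \<in> borel_measurable (F s)" "subalgebra P (F s)"
    using assms unfolding hawkes_jump_diffusion_def filtered_prob_space_def by blast+
  then show ?thesis
    by (blast intro: measurable_from_subalg)
qed

lemma is_intensity_regression_borel_measurable:
  assumes "is_intensity_regression P X lam t f"
  shows "f \<in> borel_measurable borel"
proof -
  \<comment> \<open>The versions \<open>\<phi> j\<close> are common to all observation times, so the
    single instance \<open>t 1 0\<close> already yields their measurability.\<close>
  obtain \<phi> where "\<forall>j. is_regression P (\<lambda>\<omega>. lam (t 1 0) \<omega> $ j) (X (t 1 0)) (\<phi> j)"
    and f: "f = (\<lambda>x. \<Sum>j\<in>UNIV. \<phi> j x)"
    using assms unfolding is_intensity_regression_def by force
  then have [measurable]: "\<phi> j \<in> borel_measurable borel" for j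
    unfolding is_regression_def by blast
  show ?thesis unfolding f by measurable
qed

theorem mainTheorem6:
  fixes \<alpha> :: real and \<zeta> :: "real^'m::finite" and c :: "real^'m^'m"
    and b \<sigma> a :: "real \<Rightarrow> real" and a\<^sub>1 :: real
    and P :: "'w measure" and F :: "real \<Rightarrow> 'w measure"
    and W X :: "real \<Rightarrow> 'w \<Rightarrow> real" and N :: "'m \<Rightarrow> real \<Rightarrow> 'w \<Rightarrow> nat"
    and lam :: "real \<Rightarrow> 'w \<Rightarrow> real^'m" and \<pi> :: "(real \<times> (real^'m)) measure"
    and t :: "nat \<Rightarrow> nat \<Rightarrow> real" and A :: "real set" and lo hi :: real
    and \<M> :: "nat \<Rightarrow> 'i set" and S :: "'i \<Rightarrow> (real \<Rightarrow> real) set" and D :: "'i \<Rightarrow> nat"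
    and \<phi> :: "real \<Rightarrow> real" and \<beta> f\<^sub>0 :: real and f g :: "real \<Rightarrow> real"
    and s_hat g_hat :: "nat \<Rightarrow> 'i \<Rightarrow> 'w \<Rightarrow> real \<Rightarrow> real"
    and f_hat :: "nat \<Rightarrow> real \<Rightarrow> 'w \<Rightarrow> real \<Rightarrow> real"
    and n :: nat and m\<^sub>1 m\<^sub>2 :: 'i and h :: real
  assumes "\<alpha> > 0" and "\<And>i. \<zeta> $ i > 0" and "\<And>i j. c $ i $ j > 0"
    and "hawkes_jump_diffusion \<alpha> \<zeta> c b \<sigma> a P F W N X lam"
    and "coefficient_assumption b \<sigma> a a\<^sub>1"
    and "hawkes_assumption \<alpha> \<zeta> c"
    and "invariant_law TYPE('w) \<alpha> \<zeta> c b \<sigma> a \<pi>"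
    and "distr P borel (\<lambda>\<omega>. (X 0 \<omega>, lam 0 \<omega>)) = \<pi>"
    and "observation_scheme t"
    and "A = {lo..hi}" and "lo \<le> hi"
    and "\<And>n m. n \<ge> 1 \<Longrightarrow> m \<in> \<M> n \<Longrightarrow> approximation_space A (S m) (D m)"
    and "space_assumption A \<M> S D"
    and "is_intensity_regression P X lam t f"
    and "g = (\<lambda>x. (\<sigma> x)\<^sup>2 + (a x)\<^sup>2 * f x)"
    and "f\<^sub>0 > 0" and "\<And>x. x \<in> A \<Longrightarrow> f x > f\<^sub>0"
    and "0 < \<beta>" and "\<beta> < 1/2" and "truncation \<phi>"
    and "\<And>n m. n \<ge> 1 \<Longrightarrow> m \<in> \<M> n \<Longrightarrow>
           least_squares_estimator P X t A n (S m) (truncated_sq_increment t \<phi> \<beta> n) (s_hat n m)"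
    and "\<And>n m. n \<ge> 1 \<Longrightarrow> m \<in> \<M> n \<Longrightarrow>
           least_squares_estimator P X t A n (S m) (sq_increment t n) (g_hat n m)"
    and "\<And>n h. n \<ge> 1 \<Longrightarrow> h > 0 \<Longrightarrow> random_function P (f_hat n h)"
    and "n \<ge> 1" and "m\<^sub>1 \<in> \<M> n" and "m\<^sub>2 \<in> \<M> n" and "h > 0"
  shows "risk P X t A n
           (jump_coefficient_estimator f\<^sub>0 (g_hat n m\<^sub>2) (s_hat n m\<^sub>1) (f_hat n h)) (\<lambda>x. (a x)\<^sup>2)
         \<le> ennreal (12 / f\<^sub>0\<^sup>2) *
           (risk P X t A n (g_hat n m\<^sub>2) g
            + risk P X t A n (s_hat n m\<^sub>1) (\<lambda>x. (\<sigma> x)\<^sup>2)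
            + ennreal (2 * a\<^sub>1 ^ 4) * risk P X t A n (f_hat n h) f)"
\<comment> \<open>What remains is the pointwise bound on \<open>A\<close>, with constants
  \<open>12 / f\<^sub>0\<^sup>2\<close> and \<open>2 * a\<^sub>1 ^ 4\<close>, together with
  measurability and sign conditions.\<close>
proof (rule risk_le_linear)
  note coefficients = assms(5)[unfolded coefficient_assumption_def C2_def]
  have [measurable]: "\<sigma> \<in> borel_measurable borel" "a \<in> borel_measurable borel"
    using coefficients by (auto intro: differentiable_on_imp_borel_measurable)
  show f_measurable [measurable]: "f \<in> borel_measurable borel"
    using assms(14) by (rule is_intensity_regression_borel_measurable)
  show "(\<lambda>x. (\<sigma> x)\<^sup>2) \<in> borel_measurable borel" by measurable
  show "g \<in> borel_measurable borel" unfolding assms(15) by measurable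
  show "A \<in> sets borel" using assms(10) by simp
  show "random_function P (g_hat n m\<^sub>2)" "random_function P (s_hat n m\<^sub>1)"
    using assms(21,22,24-26) unfolding least_squares_estimator_def by blast+
  show "random_function P (f_hat n h)"
    using assms(23,24,27) by blast
  show "X (t n i) \<in> borel_measurable P" if "i < n" for i
    using hawkes_jump_diffusion_measurable[OF assms(4)]
      observation_time_nonneg[OF assms(9,24)] that by simp
  show "(jump_coefficient_estimator f\<^sub>0 (g_hat n m\<^sub>2) (s_hat n m\<^sub>1) (f_hat n h) \<omega> x - (a x)\<^sup>2)\<^sup>2
      \<le> 12 / f\<^sub>0\<^sup>2 * ((g_hat n m\<^sub>2 \<omega> x - g x)\<^sup>2 + (s_hat n m\<^sub>1 \<omega> x - (\<sigma> x)\<^sup>2)\<^sup>2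
        + 2 * a\<^sub>1 ^ 4 * (f_hat n h \<omega> x - f x)\<^sup>2)" if "x \<in> A" for \<omega> x
  proof -
    have "\<bar>a x\<bar> \<le> a\<^sub>1"
      using coefficients by (simp add: less_imp_le)
    \<comment> \<open>Expanding g by its definition brings the goal to the form of the scalar bound,
      with \<open>s\<close> being \<open>(\<sigma> x)\<^sup>2\<close>; the lower bound on
      \<open>f x\<close> holds because \<open>x\<close> lies in \<open>A\<close>.\<close>
    with assms(16,17) that show ?thesis
      unfolding jump_coefficient_estimator_def assms(15)
      by (intro thresholded_ratio_error_le) auto
  qed
qed simp_all

end
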